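(* Let $k\geq 5$ be an odd integer and let $E_0(z)$ and $E_{\frac12}(z)$ be the weight $\frac{k}{2}$ Eisenstein series of $\Gamma_0(4)$ defined in the context. There is an absolute constant $C>0$ such that for all sufficiently large odd $k$, each of the two real-variable functions $y\mapsto E_0(-\tfrac12+iy)$ and $y\mapsto E_{\frac12}(\tfrac12+iy)$ has at least $\frac{k}{8}-C\sqrt{k\log k}$ zeroes in the range $y\geq \frac12$.
   Context: Throughout, $k\geq5$ is odd, $z=x+iy$ lies in the upper half-plane, and $w^{k/2}$ denotes the principal branch ($w^{k/2}=|w|^{k/2}e^{ik\arg(w)/2}$ with $\arg w\in(-\pi,\pi]$). For integers $u>0$ odd, $\epsilon_u=1$ if $u\equiv1\pmod 4$ and $\epsilon_u=i$ if $u\equiv 3\pmod 4$; $\left(\frac{a}{b}\right)$ is the Jacobi symbol (with $\left(\frac{a}{1}\right)=1$). For a fraction $\frac{m}{n}$ (numerator $m$, denominator $n>0$ as written) let $g(\frac{m}{n})=\sum_{a \bmod n}e^{2\pi i a^2 m/n}$ and $G(\frac{m}{n})=g(\frac mn)/|g(\frac mn)|$. Define $$E_0(z)=\sum_{\substack{u>0,\ v\in\mathbb Z\\ \gcd(u,2v)=1}}\frac{\left(\frac{-v}{u}\right)\epsilon_u^k}{(uz+v)^{k/2}},\qquad E_{\frac12}(z)=e^{-\pi i k/4}\sum_{\substack{d>0,\ c\in\mathbb Z\\ \gcd(2c,d)=1}}\frac{G\left(\frac{d-2c}{8d}\right)^k}{(dz+c)^{k/2}}.$$ *)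

theory Defs
  imports "HOL-Analysis.Analysis" "HOL-Number_Theory.Number_Theory"
begin

(* Meant for odd n > 0. For n = 1 the product is empty, so the value is 1. *)
definition jacobi :: "int \<Rightarrow> int \<Rightarrow> int" where
  "jacobi a n = (\<Prod>p\<in>#prime_factorization n. Legendre a p)"

(* Meant for odd u > 0 only. *)
definition eps :: "int \<Rightarrow> complex" where
  "eps u = (if [u = 1] (mod 4) then 1 else \<i>)"

(* The Gauss sum of the fraction m/n depends on how the fraction is written,
   so numerator and denominator are separate arguments. *)
definition gauss_sum :: "int \<Rightarrow> int \<Rightarrow> complex" where
  "gauss_sum m n = (\<Sum>a\<in>{0..<n}. exp (2 * of_real pi * \<i> * of_int (a\<^sup>2) * of_int m / of_int n))"

definition gauss_sign :: "int \<Rightarrow> int \<Rightarrow> complex" where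
  "gauss_sign m n = gauss_sum m n / of_real (norm (gauss_sum m n))"

(* Both series converge absolutely for Im z > 0 and k > 4, so the unordered sums are genuine there.
   Complex powr is exp (a * Ln w), with Im (Ln w) in (-pi, pi]: the principal branch. *)
definition E_zero :: "nat \<Rightarrow> complex \<Rightarrow> complex" where
  "E_zero k z =
    (\<Sum>\<^sub>\<infinity>(u, v) \<in> {(u :: int, v :: int). u > 0 \<and> gcd u (2 * v) = 1}.
       of_int (jacobi (- v) u) * eps u ^ k / (of_int u * z + of_int v) powr (of_nat k / 2))"

definition E_half :: "nat \<Rightarrow> complex \<Rightarrow> complex" where
  "E_half k z = exp (- (of_real pi * \<i> * of_nat k / 4)) *
    (\<Sum>\<^sub>\<infinity>(d, c) \<in> {(d :: int, c :: int). d > 0 \<and> gcd (2 * c) d = 1}.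
       gauss_sign (d - 2 * c) (8 * d) ^ k / (of_int d * z + of_int c) powr (of_nat k / 2))"

end

theory Submission imports Defs begin

text \<open>
  Both series become a sum over the same coprime pairs on the line with real part 1/2 (for the first
  one by translating by 1), and there the reflection \<open>(d, c) \<mapsto> (d, - d - c)\<close> conjugates the terms, so
  that the sum is real after multiplication by a constant. With \<open>y = tan \<theta> / 2\<close>, the two terms closest
  to the origin add up to a positive multiple of \<open>2 cos (k \<theta> / 2 - \<psi>)\<close>. As long as \<open>pi / 2 - \<theta>\<close> is at
  least a constant times \<open>sqrt (ln k / k)\<close>, all other terms together are smaller than the extreme
  values of this cosine. Hence the sum changes sign between consecutive extrema, and there are about
  \<open>k / 8 - O(sqrt (k ln k))\<close> of these for \<open>pi / 4 \<le> \<theta>\<close>.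
\<close>

section \<open>The coefficients\<close>

text \<open>For odd \<open>n\<close> only; for positive odd \<open>n\<close> this is the Jacobi symbol of \<open>- 1\<close> over \<open>n\<close>.\<close>
definition chi4 :: "int \<Rightarrow> int" where
  "chi4 n = (if [n = 1] (mod 4) then 1 else - 1)"

section \<open>Quadratic symbols at negated arguments\<close>

lemma chi4_mult:
  assumes "odd a" "odd b"
  shows "chi4 (a * b) = chi4 a * chi4 b"
proof -
  have ma: "a mod 4 = 1 \<or> a mod 4 = 3" and mb: "b mod 4 = 1 \<or> b mod 4 = 3"
    using assms by presburger+
  have "a * b mod 4 = (a mod 4) * (b mod 4) mod 4"
    by (simp add: mod_mult_eq)
  with ma mb show ?thesis
    by (auto simp: chi4_def cong_def)
qed

text \<open>Oddness is carried through the induction because \<open>chi4_mult\<close> needs it for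
  the remaining product.\<close>

lemma chi4_prod_mset:
  assumes "\<And>p. p \<in># M \<Longrightarrow> odd p"
  shows "odd (prod_mset M) \<and> chi4 (prod_mset M) = (\<Prod>p\<in>#M. chi4 p)"
  using assms
proof (induction M)
  case empty
  then show ?case by (simp add: chi4_def)
next
  case (add x M)
  then show ?case by (simp add: chi4_mult)
qed

lemma minus_one_power_half:
  assumes "odd p" "p > (0::int)"
  shows "(- 1::int) ^ nat ((p - 1) div 2) = chi4 p"
proof (cases "[p = 1] (mod 4)")
  case True
  then have "even ((p - 1) div 2)" by (simp add: cong_def) presburger
  with True assms show ?thesis by (simp add: chi4_def even_nat_iff)
next
  case False
  with assms have "odd ((p - 1) div 2)" by (simp add: cong_def) presburger
  with False assms show ?thesis by (simp add: chi4_def even_nat_iff)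
qed

lemma abs_Legendre_le: "\<bar>Legendre a p\<bar> \<le> 1"
  by (simp add: Legendre_def)

text \<open>Euler's criterion gives the identity modulo p. Both sides have absolute value at most 1,
  so they differ by at most 2 < p and the congruence is an equality.\<close>

lemma Legendre_minus:
  assumes "prime p" "odd p"
  shows "Legendre (- a) p = chi4 p * Legendre a p"
proof -
  define q where "q = nat p"
  have p2: "2 < p" using assms prime_ge_2_int[of p] by (cases "p = 2") auto
  then have pq: "p = int q" "2 < q" by (simp_all add: q_def)
  then have q: "prime q" using assms by simp
  define n where "n = (q - 1) div 2"
  have n: "n = nat ((p - 1) div 2)" using pq by (simp add: n_def nat_div_distrib nat_diff_distrib)
  have "[Legendre (- a) p = (- a) ^ n] (mod p)"
    using euler_criterion[OF q pq(2)] by (simp add: n_def pq)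
  also have "(- a) ^ n = chi4 p * a ^ n"
    using minus_one_power_half[of p] assms p2 by (simp add: n power_minus[of a])
  also have "[chi4 p * a ^ n = chi4 p * Legendre a p] (mod p)"
    using euler_criterion[OF q pq(2)] by (intro cong_mult) (simp_all add: n_def pq cong_sym_eq)
  finally have d: "p dvd Legendre (- a) p - chi4 p * Legendre a p"
    by (simp add: cong_iff_dvd_diff)
  have "\<bar>Legendre (- a) p - chi4 p * Legendre a p\<bar> < p"
    using abs_Legendre_le[of a p] abs_Legendre_le[of "-a" p] p2
    by (auto simp: chi4_def)
  with d have "Legendre (- a) p - chi4 p * Legendre a p = 0"
    using dvd_imp_le_int[of "Legendre (- a) p - chi4 p * Legendre a p" p] p2 by linarith
  then show ?thesis by simp
qed

lemma Legendre_cong: "[a = b] (mod p) \<Longrightarrow> Legendre a p = Legendre b p"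
  by (simp add: Legendre_def QuadRes_def cong_def)

lemma prime_factor_odd:
  "odd u \<Longrightarrow> p \<in> prime_factors (u::int) \<Longrightarrow> prime p \<and> odd p"
  by (metis dvd_trans in_prime_factors_iff)

lemma jacobi_minus:
  assumes "odd u" "u > 0"
  shows "jacobi (- a) u = chi4 u * jacobi a u"
proof -
  have "jacobi (- a) u = (\<Prod>p\<in>#prime_factorization u. chi4 p * Legendre a p)"
    unfolding jacobi_def using assms prime_factor_odd[of u]
    by (intro arg_cong[where f = prod_mset] image_mset_cong) (auto intro!: Legendre_minus)
  also have "\<dots> = (\<Prod>p\<in>#prime_factorization u. chi4 p) * jacobi a u"
    by (simp add: jacobi_def prod_mset.distrib)
  also have "(\<Prod>p\<in>#prime_factorization u. chi4 p) = chi4 u"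
    using chi4_prod_mset[of "prime_factorization u"] prime_factor_odd[of u] assms
    by (simp add: prod_mset_prime_factorization)
  finally show ?thesis .
qed

lemma jacobi_cong:
  assumes "[a = b] (mod u)" 
  shows "jacobi a u = jacobi b u"
proof -
  have "Legendre a p = Legendre b p" if "p \<in># prime_factorization u" for p
    using that assms by (intro Legendre_cong) (auto intro: cong_dvd_modulus)
  then show ?thesis unfolding jacobi_def
    by (intro arg_cong[where f = prod_mset] image_mset_cong)
qed

lemma abs_jacobi_le: "\<bar>jacobi a u\<bar> \<le> 1"
proof -
  have "\<bar>\<Prod>p\<in>#M. Legendre a p\<bar> \<le> 1" for M
  proof (induction M)
    case (add x M)
    then show ?case using abs_Legendre_le[of a x]
      by (simp add: abs_mult mult_le_one)
  qed simp
  then show ?thesis by (simp add: jacobi_def)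
qed

lemma norm_eps [simp]: "norm (eps u) = 1"
  by (simp add: eps_def)

text \<open>The sign is the one in \<open>jacobi_minus\<close>; for odd k the two match under the
  reflection.\<close>

lemma cnj_eps: "cnj (eps u) = of_int (chi4 u) * eps u"
  by (simp add: eps_def chi4_def)

section \<open>Normalized Gauss sums with denominator 8 d\<close>

lemma gauss_sign_minus: "gauss_sign (- m) n = cnj (gauss_sign m n)"
proof -
  have "gauss_sum (- m) n = cnj (gauss_sum m n)"
    by (simp add: gauss_sum_def exp_cnj)
  then show ?thesis by (simp add: gauss_sign_def)
qed

text \<open>An inequality avoids showing that the Gauss sum is nonzero: if it vanishes, the quotient
  is 0 by convention.\<close>

lemma norm_gauss_sign_le: "norm (gauss_sign m n) \<le> 1"
  by (simp add: gauss_sign_def norm_divide)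

lemma exp_pi_i_int: "exp (of_real pi * \<i> * of_int n) = (if even n then 1 else - 1 :: complex)"
proof (cases "even n")
  case True
  then obtain m where "n = 2 * m" by blast
  then have "exp (of_real pi * \<i> * of_int n) = (1::complex)"
    by (subst exp_eq_1) auto
  with True show ?thesis by simp
next
  case False
  then obtain m where m: "n = 2 * m + 1" by (auto elim: oddE)
  have "exp (of_real pi * \<i> * of_int (2 * m)) = (1::complex)"
    by (subst exp_eq_1) auto
  moreover have "exp (of_real pi * \<i> * of_int n) =
      exp (of_real pi * \<i> * of_int (2 * m)) * exp (of_real pi * \<i> :: complex)"
    by (simp add: m exp_add[symmetric] algebra_simps)
  ultimately show ?thesis using False by simp
qed

lemma sum_four_blocks_antiperiodic:
  fixes H :: "int \<Rightarrow> complex"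
  assumes "\<And>a. H (a + n) = - H a" "n \<ge> 0"
  shows "(\<Sum>a\<in>{0..<4*n}. H a) = 0"
proof -
  have shift: "(\<Sum>a\<in>{x + n..<x + 2 * n}. H a) = - (\<Sum>a\<in>{x..<x + n}. H a)" for x
  proof -
    have "(\<Sum>a\<in>{x + n..<x + 2 * n}. H a) = (\<Sum>a\<in>{x..<x + n}. H (a + n))"
      by (rule sum.reindex_bij_witness[of _ "\<lambda>a. a + n" "\<lambda>a. a - n"]) auto
    then show ?thesis by (simp add: assms sum_negf)
  qed
  have split: "(\<Sum>a\<in>{x..<x + 2 * n}. H a) = 0" for x
  proof -
    have "{x..<x + 2 * n} = {x..<x + n} \<union> {x + n..<x + 2 * n}" using assms(2) by auto
    then have "(\<Sum>a\<in>{x..<x + 2 * n}. H a) =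
        (\<Sum>a\<in>{x..<x + n}. H a) + (\<Sum>a\<in>{x + n..<x + 2 * n}. H a)"
      by (simp add: sum.union_disjoint)
    then show ?thesis using shift[of x] by simp
  qed
  have "{0..<4*n} = {0..<0 + 2 * n} \<union> {2 * n..<2 * n + 2 * n}" using assms(2) by auto
  then have "(\<Sum>a\<in>{0..<4*n}. H a) =
      (\<Sum>a\<in>{0..<0 + 2 * n}. H a) + (\<Sum>a\<in>{2 * n..<2 * n + 2 * n}. H a)"
    by (simp add: sum.union_disjoint)
  then show ?thesis using split[of 0] split[of "2 * n"] by simp
qed

text \<open>Needed for the reflection of (d, c), which turns the numerator m = d - 2 c into - m + 4
  d. Adding 4 d to the numerator multiplies the summand at a by the sign of the parity of a.\<close>

lemma gauss_sum_add_half: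
  assumes "odd m" "odd d" "d > 0"
  shows "gauss_sum (m + 4 * d) (8 * d) = - gauss_sum m (8 * d)"
proof -
  define f :: "int \<Rightarrow> complex" where
    "f a = exp (2 * of_real pi * \<i> * of_int (a\<^sup>2) * of_int m / of_int (8 * d))" for a
  \<comment> \<open>The sum of the two summands at \<open>a\<close>: odd \<open>a\<close> cancel, and \<open>a \<mapsto> a + 2 d\<close> flips the sign of the rest.\<close>
  define H where "H a = f a * (if even a then 2 else 0)" for a
  have d0: "(of_int d :: complex) \<noteq> 0" using assms by simp
  have f4: "exp (2 * of_real pi * \<i> * of_int (a\<^sup>2) * of_int (m + 4 * d) / of_int (8 * d)) =
      f a * (if even a then 1 else - 1)" for a
  proof -
    have "2 * of_real pi * \<i> * of_int (a\<^sup>2) * of_int (m + 4 * d) / of_int (8 * d) =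
      2 * of_real pi * \<i> * of_int (a\<^sup>2) * of_int m / of_int (8 * d) + of_real pi * \<i> * of_int (a\<^sup>2)"
      using d0 by (simp add: field_simps)
    then show ?thesis by (simp only: exp_add exp_pi_i_int f_def) auto
  qed
  \<comment> \<open>The shift contributes the sign of the parity of (a + d) m; as d and m are odd,
    this is -1 exactly for even a.\<close>
  have fs: "f (a + 2 * d) = f a * (if even a then - 1 else 1)" for a
  proof -
    have "2 * of_real pi * \<i> * of_int ((a + 2 * d)\<^sup>2) * of_int m / of_int (8 * d) =
      2 * of_real pi * \<i> * of_int (a\<^sup>2) * of_int m / of_int (8 * d) +
      of_real pi * \<i> * of_int ((a + d) * m)"
      using d0 by (simp add: field_simps power2_eq_square)
    then show ?thesis using assms by (simp only: exp_add exp_pi_i_int f_def) auto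
  qed
  have "(\<Sum>a\<in>{0..<4*(2*d)}. H a) = 0"
    using assms by (intro sum_four_blocks_antiperiodic) (auto simp: H_def fs)
  moreover have "gauss_sum m (8 * d) + gauss_sum (m + 4 * d) (8 * d) = (\<Sum>a\<in>{0..<4*(2*d)}. H a)"
    unfolding gauss_sum_def f4 f_def[symmetric] sum.distrib[symmetric]
    by (intro sum.cong) (auto simp: H_def)
  ultimately show ?thesis by (simp add: add_eq_0_iff)
qed

lemma gauss_sign_add_half:
  assumes "odd m" "odd d" "d > 0"
  shows "gauss_sign (m + 4 * d) (8 * d) = - gauss_sign m (8 * d)"
  using gauss_sum_add_half[OF assms] by (simp add: gauss_sign_def)

text \<open>The coefficient of the main term. With z an eighth root of unity and z ^ 4 = -1, the
  four odd squares each contribute z, and the four even ones cancel.\<close>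

lemma gauss_sign_1_8: "gauss_sign 1 8 = cis (pi / 4)"
proof -
  define z :: complex where "z = cis (pi / 4)"
  have e: "exp (2 * of_real pi * \<i> * of_int (a\<^sup>2) * of_int 1 / of_int 8) = z ^ nat (a\<^sup>2)" for a
  proof -
    have "z ^ nat (a\<^sup>2) = cis (of_int (a\<^sup>2) * (pi / 4))"
    proof -
      have "z ^ nat (a\<^sup>2) = cis (real (nat (a\<^sup>2)) * (pi / 4))"
        unfolding z_def by (rule Complex.DeMoivre)
      also have "real (nat (a\<^sup>2)) = of_int (a\<^sup>2)" by (subst of_nat_nat) auto
      finally show ?thesis .
    qed
    also have "\<dots> = exp (2 * of_real pi * \<i> * of_int (a\<^sup>2) * of_int 1 / of_int 8)"
      unfolding cis_conv_exp by (simp add: mult_ac)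
    finally show ?thesis ..
  qed
  have z4: "z ^ 4 = - 1" by (simp add: z_def Complex.DeMoivre cis_pi)
  have "z ^ (4 * n + j) = (- 1) ^ n * z ^ j" for n j
    by (simp add: power_add power_mult z4)
  from this[of 2 1] this[of 4 0] this[of 6 1] this[of 9 0] this[of 12 1]
  have p: "z ^ 9 = z" "z ^ 16 = 1" "z ^ 25 = z" "z ^ 36 = - 1" "z ^ 49 = z" by simp_all
  have "{0..<8::int} = {0,1,2,3,4,5,6,7}" by auto
  then have "gauss_sum 1 8 = 4 * z"
    unfolding gauss_sum_def e by (simp add: p z4)
  then show ?thesis by (simp add: gauss_sign_def norm_mult z_def)
qed

section \<open>Reflection-symmetric series on the line with real part 1/2\<close>

definition coprime_pairs :: "(int \<times> int) set" where
  "coprime_pairs = {(d, c). d > 0 \<and> gcd d (2 * c) = 1}"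

lemma coprime_pairs_odd:
  assumes "(d, c) \<in> coprime_pairs"
  shows "d > 0" "odd d"
proof -
  show "d > 0" using assms by (simp add: coprime_pairs_def)
  have "coprime d 2" using assms by (simp add: coprime_pairs_def coprime_iff_gcd_eq_1[symmetric])
  then show "odd d" by simp
qed

text \<open>The first two maps come from translating the variable by 1 and are mutually inverse; the
  third is the reflection.\<close>

lemma coprime_pairs_shift:
  assumes "(d, c) \<in> coprime_pairs"
  shows "(d, c + d) \<in> coprime_pairs" "(d, c - d) \<in> coprime_pairs" "(d, - d - c) \<in> coprime_pairs"
proof -
  have *: "d > 0" "odd d" using coprime_pairs_odd[OF assms] .
  have "coprime d c" using assms by (simp add: coprime_pairs_def coprime_iff_gcd_eq_1[symmetric])
  then have "gcd d c = 1" by simp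
  moreover have "c + d = 1 * d + c" "c - d = (- 1) * d + c" "- d - c = (- 1) * d + - c" by simp_all
  ultimately have "gcd d (c + d) = 1" "gcd d (c - d) = 1" "gcd d (- d - c) = 1"
    by (simp_all only: gcd_add_mult gcd_neg2)
  with * show "(d, c + d) \<in> coprime_pairs" "(d, c - d) \<in> coprime_pairs"
      "(d, - d - c) \<in> coprime_pairs"
    by (simp_all add: coprime_pairs_def coprime_iff_gcd_eq_1[symmetric])
qed

section \<open>A summable majorant over the lattice\<close>

lemma summable_on_inverse_square_int: "(\<lambda>n::int. 1 / (of_int n)\<^sup>2 :: real) summable_on UNIV"
proof -
  have "summable (\<lambda>n. inverse (real n ^ 2))"
    by (rule inverse_power_summable) simp
  then have *: "(\<lambda>n::nat. 1 / (real n)\<^sup>2) summable_on UNIV"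
    by (subst summable_on_UNIV_nonneg_real_iff) (simp_all add: inverse_eq_divide)
  have "(\<lambda>n::int. 1 / (of_int n)\<^sup>2 :: real) summable_on range int"
    using * by (subst summable_on_reindex) (auto simp: inj_on_def o_def)
  moreover have "(\<lambda>n::int. 1 / (of_int n)\<^sup>2 :: real) summable_on range (\<lambda>n. - int n)"
    using * by (subst summable_on_reindex) (auto simp: inj_on_def o_def)
  ultimately have "(\<lambda>n::int. 1 / (of_int n)\<^sup>2 :: real) summable_on range int \<union> range (\<lambda>n. - int n)"
    by (rule summable_on_union)
  also have "range int \<union> range (\<lambda>n. - int n) = UNIV"
  proof -
    have "n \<in> range int \<union> range (\<lambda>n. - int n)" for n
      by (cases n rule: int_cases2) auto
    then show ?thesis by blast
  qed
  finally show ?thesis .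
qed

text \<open>Twice the real part of \<open>d z + c\<close> is the odd number \<open>2 c + d\<close>, so the denominator is nonzero on
  \<^const>\<open>coprime_pairs\<close>.\<close>
definition lattice_majorant :: "int \<times> int \<Rightarrow> real" where
  "lattice_majorant = (\<lambda>(d, c). 1 / ((of_int d)\<^sup>2 * (of_int (2 * c + d))\<^sup>2))"

lemma lattice_majorant_nonneg: "0 \<le> lattice_majorant p"
  by (simp add: lattice_majorant_def split: prod.split)

text \<open>The map (d, c) to (d, 2 c + d) is injective, so the sum is part of a product of two
  inverse-square sums. Zero denominators contribute 0, hence any index set is admissible.\<close>

lemma summable_lattice_majorant: "lattice_majorant summable_on A"
proof -
  let ?f = "\<lambda>n::int. 1 / (of_int n)\<^sup>2 :: real"
  have "(\<lambda>(d, e). ?f d * ?f e) summable_on UNIV \<times> UNIV"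
  proof (rule summable_on_SigmaI)
    show "((\<lambda>e. case (d, e) of (d, e) \<Rightarrow> ?f d * ?f e) has_sum ?f d * infsum ?f UNIV) UNIV" for d
      unfolding prod.case
      by (intro has_sum_cmult_right has_sum_infsum summable_on_inverse_square_int)
    show "(\<lambda>d. ?f d * infsum ?f UNIV) summable_on UNIV"
      by (intro summable_on_cmult_left summable_on_inverse_square_int)
  qed auto
  then have "(\<lambda>(d, e). ?f d * ?f e) summable_on range (\<lambda>(d, c). (d, 2 * c + d))"
    by (rule summable_on_subset_banach) auto
  then have "((\<lambda>(d, e). ?f d * ?f e) \<circ> (\<lambda>(d, c). (d, 2 * c + d))) summable_on UNIV"
    by (subst (asm) summable_on_reindex) (auto simp: inj_on_def)
  moreover have "(\<lambda>(d, e). ?f d * ?f e) \<circ> (\<lambda>(d, c). (d, 2 * c + d)) = lattice_majorant"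
    by (auto simp: lattice_majorant_def fun_eq_iff)
  ultimately show ?thesis
    using summable_on_subset_banach by fastforce
qed

text \<open>Two of the s powers pay for summability over D and E, through 4 D E \<le> (E + D)^2; the
  other s - 2 keep the uniform ratio, which yields decay in k.\<close>

lemma powr_ratio_le:
  fixes X D E s \<rho> :: real
  assumes "X \<ge> 1" "D \<ge> 1" "E \<ge> 1" "s \<ge> 2" "(1 + X) / (E + D * X) \<le> \<rho>"
  shows "((1 + X) / (E + D * X)) powr s \<le> (1 + X)\<^sup>2 / (4 * (D * E)) * \<rho> powr (s - 2)"
proof -
  define t where "t = (1 + X) / (E + D * X)"
  have pos: "E + D * X > 0" using assms by (simp add: add_pos_nonneg)
  have t0: "t > 0" using assms pos by (simp add: t_def)
  have "D * 1 \<le> D * X" using assms by (intro mult_left_mono) auto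
  then have "E + D \<le> E + D * X" by simp
  then have "(E + D)\<^sup>2 \<le> (E + D * X)\<^sup>2" using assms by (intro power_mono) auto
  moreover have "4 * (D * E) \<le> (E + D)\<^sup>2"
    using zero_le_power2[of "E - D"] by (simp add: power2_eq_square algebra_simps)
  ultimately have "4 * (D * E) \<le> (E + D * X)\<^sup>2" by linarith
  then have t2: "t\<^sup>2 \<le> (1 + X)\<^sup>2 / (4 * (D * E))"
    unfolding t_def power_divide using assms by (intro divide_left_mono mult_pos_pos zero_less_power pos) auto
  have "t powr s = t powr 2 * t powr (s - 2)"
    by (simp flip: powr_add)
  also have "t powr 2 = t\<^sup>2" using t0 by simp
  also have "t\<^sup>2 * t powr (s - 2) \<le> (1 + X)\<^sup>2 / (4 * (D * E)) * \<rho> powr (s - 2)"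
    using t2 t0 assms by (intro mult_mono powr_mono2) (auto simp: t_def)
  finally show ?thesis by (simp add: t_def)
qed

text \<open>Common form of both series; \<open>b\<close> also absorbs the constant that makes the
  sum real. The factor \<open>cis (pi * k / 2)\<close> is the phase that the power of the
  denominator acquires under the reflection. The bound 16 ensures k / 4 - 2 \<ge> k / 8.\<close>

locale symmetric_series =
  fixes k :: nat and b :: "int \<times> int \<Rightarrow> complex" and \<psi> :: real
  assumes k_ge: "k \<ge> 16"
    and norm_b: "p \<in> coprime_pairs \<Longrightarrow> norm (b p) \<le> 1"
    and b_reflect: "(d, c) \<in> coprime_pairs \<Longrightarrow> b (d, - d - c) = cis (pi * k / 2) * cnj (b (d, c))"
    and b_main: "b (1, 0) = cis \<psi>"
begin

definition w :: "real \<Rightarrow> int \<times> int \<Rightarrow> complex" where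
  "w y = (\<lambda>(d, c). of_int d * Complex (1/2) y + of_int c)"

definition tm :: "real \<Rightarrow> int \<times> int \<Rightarrow> complex" where
  "tm y p = b p / w y p powr (of_nat k / 2)"

definition F :: "real \<Rightarrow> complex" where
  "F y = infsum (tm y) coprime_pairs"

text \<open>The largest ratio of the squared norms of a main denominator and of any other denominator.\<close>
definition \<rho> :: "real \<Rightarrow> real" where
  "\<rho> y = (1 + 4 * y\<^sup>2) / (9 + 4 * y\<^sup>2)"

section \<open>Termwise estimates and continuity in y\<close>

lemma w_eq: "w y (d, c) = Complex (of_int (2 * c + d) / 2) (of_int d * y)"
  by (simp add: w_def complex_eq_iff field_simps)

lemma norm_w_sq: "(norm (w y (d, c)))\<^sup>2 = ((of_int (2 * c + d))\<^sup>2 + (of_int d)\<^sup>2 * (4 * y\<^sup>2)) / 4"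
  unfolding w_eq cmod_power2 complex.sel by (simp add: field_simps power2_eq_square)

lemma norm_w_powr: "norm (w y p powr (of_nat k / 2)) = (norm (w y p))\<^sup>2 powr (real k / 4)"
proof -
  have "norm (w y p powr (of_real (real k / 2))) = norm (w y p) powr (real k / 2)"
    by (subst norm_powr_real_powr') auto
  also have "\<dots> = (norm (w y p)) powr (2 * (real k / 4))" by simp
  also have "\<dots> = (norm (w y p) powr 2) powr (real k / 4)" by (simp only: powr_powr)
  finally show ?thesis by simp
qed

lemma pair_squares_ge_1:
  assumes "(d, c) \<in> coprime_pairs"
  shows "(of_int d)\<^sup>2 \<ge> (1::real)" "(of_int (2 * c + d))\<^sup>2 \<ge> (1::real)"
proof -
  have *: "(of_int n)\<^sup>2 \<ge> (1::real)" if "n \<noteq> 0" for n :: int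
  proof -
    have "1 \<le> n\<^sup>2" using that by (smt (verit) zero_less_power2)
    then show ?thesis by (metis of_int_1_le_iff of_int_power)
  qed
  show "(of_int d)\<^sup>2 \<ge> (1::real)" using coprime_pairs_odd[OF assms] by (intro *) auto
  show "(of_int (2 * c + d))\<^sup>2 \<ge> (1::real)"
    using coprime_pairs_odd[OF assms] by (intro *) presburger
qed

text \<open>The factor on the left is the modulus of the main denominator raised to k / 2, so each
  term is measured against the two main ones.\<close>

lemma tm_bound:
  assumes p: "p \<in> coprime_pairs" and y: "y \<ge> 1/2"
    and r: "\<And>d c. p = (d, c) \<Longrightarrow> (1 + 4 * y\<^sup>2) / ((of_int (2 * c + d))\<^sup>2 + (of_int d)\<^sup>2 * (4 * y\<^sup>2)) \<le> r"
  shows "norm (tm y p) * ((1 + 4 * y\<^sup>2) / 4) powr (real k / 4)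
           \<le> (1 + 4 * y\<^sup>2)\<^sup>2 / 4 * r powr (real k / 4 - 2) * lattice_majorant p"
proof -
  obtain d c where dc: "p = (d, c)" by fastforce
  define D E X :: real where "D = (of_int d)\<^sup>2" and "E = (of_int (2 * c + d))\<^sup>2" and "X = 4 * y\<^sup>2"
  have DE: "D \<ge> 1" "E \<ge> 1" using pair_squares_ge_1 p dc by (auto simp: D_def E_def)
  have "(1/2)\<^sup>2 \<le> y\<^sup>2" using y by (intro power_mono) auto
  then have X: "X \<ge> 1" by (simp add: X_def power2_eq_square)
  have pos: "E + D * X > 0" using DE X by (simp add: add_pos_nonneg)
  have N: "(norm (w y p))\<^sup>2 = (E + D * X) / 4"
    unfolding dc norm_w_sq by (simp add: D_def E_def X_def)
  have "norm (tm y p) \<le> 1 / ((E + D * X) / 4) powr (real k / 4)"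
    unfolding tm_def norm_divide norm_w_powr N using norm_b[OF p] by (intro divide_right_mono) auto
  then have "norm (tm y p) * ((1 + X) / 4) powr (real k / 4) \<le>
      1 / ((E + D * X) / 4) powr (real k / 4) * ((1 + X) / 4) powr (real k / 4)"
    by (intro mult_right_mono) auto
  also have "\<dots> = ((1 + X) / (E + D * X)) powr (real k / 4)"
    using pos X by (simp add: powr_divide)
  also have "\<dots> \<le> (1 + X)\<^sup>2 / (4 * (D * E)) * r powr (real k / 4 - 2)"
    using DE X k_ge r[OF dc] by (intro powr_ratio_le) (auto simp: D_def E_def X_def)
  also have "\<dots> = (1 + X)\<^sup>2 / 4 * r powr (real k / 4 - 2) * lattice_majorant p"
    by (simp add: dc lattice_majorant_def D_def E_def)
  finally show ?thesis by (simp add: X_def)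
qed

text \<open>A crude bound independent of y, for the Weierstrass test: the ratio is at most 1, and
  the squared main denominator is at least 1/2.\<close>

lemma tm_bound_uniform:
  assumes "p \<in> coprime_pairs" "1/2 \<le> y" "y \<le> Y"
  shows "norm (tm y p) \<le> 2 powr (real k / 4) * ((1 + 4 * Y\<^sup>2)\<^sup>2 / 4 * lattice_majorant p)"
proof -
  have y2: "y\<^sup>2 \<ge> 1/4" using power_mono[of "1/2" y 2] assms by (simp add: power2_eq_square)
  have yY: "y\<^sup>2 \<le> Y\<^sup>2" using assms by (intro power_mono) auto
  have "norm (tm y p) * ((1 + 4 * y\<^sup>2) / 4) powr (real k / 4)
           \<le> (1 + 4 * y\<^sup>2)\<^sup>2 / 4 * 1 powr (real k / 4 - 2) * lattice_majorant p"
  proof (rule tm_bound)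
    fix d c assume dc: "p = (d, c)"
    have "4 * y\<^sup>2 * 1 \<le> 4 * y\<^sup>2 * (of_int d)\<^sup>2"
      using pair_squares_ge_1 assms(1) dc by (intro mult_left_mono) auto
    then show "(1 + 4 * y\<^sup>2) / ((of_int (2 * c + d))\<^sup>2 + (of_int d)\<^sup>2 * (4 * y\<^sup>2)) \<le> 1"
      using pair_squares_ge_1[of d c] assms(1) y2 unfolding dc
      by (subst divide_le_eq_1) (auto simp: algebra_simps)
  qed (use assms in auto)
  also have "\<dots> \<le> (1 + 4 * Y\<^sup>2)\<^sup>2 / 4 * lattice_majorant p"
    using yY lattice_majorant_nonneg[of p] by (auto intro!: mult_right_mono divide_right_mono power_mono)
  finally have "norm (tm y p) * ((1 + 4 * y\<^sup>2) / 4) powr (real k / 4)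
      \<le> (1 + 4 * Y\<^sup>2)\<^sup>2 / 4 * lattice_majorant p" .
  moreover have "norm (tm y p) * (1/2) powr (real k / 4) \<le> norm (tm y p) * ((1 + 4 * y\<^sup>2) / 4) powr (real k / 4)"
    using y2 by (intro mult_left_mono powr_mono2) auto
  ultimately have "norm (tm y p) * (1/2) powr (real k / 4) \<le> (1 + 4 * Y\<^sup>2)\<^sup>2 / 4 * lattice_majorant p"
    by linarith
  then have "2 powr (real k / 4) * (norm (tm y p) * (1/2) powr (real k / 4)) \<le>
      2 powr (real k / 4) * ((1 + 4 * Y\<^sup>2)\<^sup>2 / 4 * lattice_majorant p)"
    by (intro mult_left_mono) auto
  moreover have "2 powr (real k / 4) * (1/2) powr (real k / 4) = 1"
    by (simp flip: powr_mult)
  ultimately show ?thesis by (simp add: mult.left_commute mult.assoc)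
qed

lemma abs_summable_tm:
  assumes "1/2 \<le> y" "A \<subseteq> coprime_pairs"
  shows "(\<lambda>p. norm (tm y p)) summable_on A"
proof (rule Infinite_Sum.abs_summable_on_comparison_test')
  show "(\<lambda>p. 2 powr (real k / 4) * ((1 + 4 * y\<^sup>2)\<^sup>2 / 4 * lattice_majorant p)) summable_on A"
    by (intro summable_on_cmult_right summable_lattice_majorant)
qed (use assms tm_bound_uniform[of _ y y] in auto)

lemma summable_tm:
  assumes "1/2 \<le> y" "A \<subseteq> coprime_pairs"
  shows "tm y summable_on A"
  using abs_summable_tm[OF assms] by (rule Infinite_Sum.abs_summable_summable)

lemma Im_w_pos:
  assumes "p \<in> coprime_pairs" "y > 0"
  shows "Im (w y p) > 0"
  using assms coprime_pairs_odd[of "fst p" "snd p"] by (cases p) (auto simp: w_eq)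

text \<open>Each term is continuous because its denominator stays in the upper half-plane, away from
  the branch cut; the Weierstrass test passes this on to the sum.\<close>

lemma continuous_F: "continuous_on {1/2..Y} F"
proof (rule uniform_limit_theorem)
  show "uniform_limit {1/2..Y} (\<lambda>A y. \<Sum>p\<in>A. tm y p) F (finite_subsets_at_top coprime_pairs)"
    unfolding F_def[abs_def]
  proof (rule Weierstrass_m_test_general)
    show "(\<lambda>p. 2 powr (real k / 4) * ((1 + 4 * Y\<^sup>2)\<^sup>2 / 4 * lattice_majorant p)) summable_on coprime_pairs"
      by (intro summable_on_cmult_right summable_lattice_majorant)
  qed (use tm_bound_uniform in auto)
  have "continuous_on {1/2..Y} (\<lambda>y. tm y p)" if "p \<in> coprime_pairs" for p
  proof -
    obtain d c where dc: "p = (d, c)" by fastforce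
    have "continuous_on {1/2..Y} (\<lambda>y. w y p)"
      unfolding w_def dc Complex_eq by (auto intro!: continuous_intros)
    moreover have "Im (w y p) \<noteq> 0" if "y \<in> {1/2..Y}" for y
      using Im_w_pos[OF \<open>p \<in> coprime_pairs\<close>, of y] that by auto
    ultimately show ?thesis
      unfolding tm_def using that
      by (intro continuous_on_divide continuous_on_powr_complex continuous_intros) fastforce+
  qed
  then show "\<forall>\<^sub>F A in finite_subsets_at_top coprime_pairs. continuous_on {1/2..Y} (\<lambda>y. \<Sum>p\<in>A. tm y p)"
    by (intro eventually_finite_subsets_at_top_weakI continuous_on_sum) auto
qed simp

text \<open>The reflection sends a denominator w to - cnj w. As arg w lies strictly between 0 and
  pi, the principal logarithm becomes cnj (Ln w) + i pi; the resulting phase cancels the one in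
  \<open>b_reflect\<close>.\<close>

lemma tm_reflect:
  assumes "(d, c) \<in> coprime_pairs" "y > 0"
  shows "tm y (d, - d - c) = cnj (tm y (d, c))"
proof -
  let ?w = "w y (d, c)"
  have im: "Im ?w > 0" using Im_w_pos[OF assms] .
  then have w0: "?w \<noteq> 0" by auto
  have w': "w y (d, - d - c) = - cnj ?w"
    unfolding w_eq complex_eq_iff by (simp add: field_simps)
  have Ln': "Ln (- cnj ?w) = cnj (Ln ?w) + \<i> * pi"
  proof (rule Ln_unique)
    show "exp (cnj (Ln ?w) + \<i> * pi) = - cnj ?w"
    proof -
      have "exp (cnj (Ln ?w)) = cnj ?w" using w0 by (metis exp_Ln exp_cnj)
      then show ?thesis by (simp only: exp_add exp_pi_i') simp
    qed
    have "0 < Im (Ln ?w)" "Im (Ln ?w) < pi"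
      using Im_Ln_pos_lt[OF w0] im by auto
    then show "- pi < Im (cnj (Ln ?w) + \<i> * pi)" "Im (cnj (Ln ?w) + \<i> * pi) \<le> pi"
      by simp_all
  qed
  have "w y (d, - d - c) powr (of_nat k / 2) = exp (of_nat k / 2 * (cnj (Ln ?w) + \<i> * pi))"
    unfolding w' powr_def Ln' using w0 by (simp del: complex_cnj_add)
  also have "of_nat k / 2 * (cnj (Ln ?w) + \<i> * pi) = cnj (of_nat k / 2 * Ln ?w) + \<i> * of_real (pi * k / 2)"
    by (simp add: algebra_simps)
  also have "exp \<dots> = exp (cnj (of_nat k / 2 * Ln ?w)) * cis (pi * k / 2)"
    by (simp only: exp_add cis_conv_exp)
  also have "exp (cnj (of_nat k / 2 * Ln ?w)) = cnj (?w powr (of_nat k / 2))"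
    by (simp only: powr_def exp_cnj w0 if_False)
  finally show ?thesis
    by (simp add: tm_def b_reflect[OF assms(1)])
qed

lemma bij_reflect: "bij_betw (\<lambda>(d, c). (d, - d - c)) coprime_pairs coprime_pairs"
  by (rule bij_betwI[of _ _ _ "\<lambda>(d, c). (d, - d - c)"]) (auto simp: coprime_pairs_shift)

lemma Im_F:
  assumes "y > 0"
  shows "Im (F y) = 0"
proof -
  have "cnj (F y) = infsum (\<lambda>p. cnj (tm y p)) coprime_pairs"
    by (simp add: F_def)
  also have "\<dots> = infsum (\<lambda>p. tm y ((\<lambda>(d, c). (d, - d - c)) p)) coprime_pairs"
    using tm_reflect[OF _ assms] by (intro infsum_cong) auto
  also have "\<dots> = F y"
    unfolding F_def by (rule infsum_reindex_bij_betw[OF bij_reflect])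
  finally have "Im (cnj (F y)) = Im (F y)" by (rule arg_cong)
  then show ?thesis by simp
qed

text \<open>The pair (1, -1) is the reflection of (1, 0), so these two terms are conjugate.\<close>

lemma F_split:
  assumes "y \<ge> 1/2"
  shows "Re (F y) = 2 * Re (tm y (1, 0)) + Re (infsum (tm y) (coprime_pairs - {(1, 0), (1, - 1)}))"
proof -
  have sub: "{(1, 0), (1, - 1)} \<subseteq> coprime_pairs" by (auto simp: coprime_pairs_def)
  have "F y = infsum (tm y) ({(1, 0), (1, - 1)} \<union> (coprime_pairs - {(1, 0), (1, - 1)}))"
    unfolding F_def Un_Diff_cancel by (simp only: Un_absorb1[OF sub])
  also have "\<dots> = infsum (tm y) {(1, 0), (1, - 1)} + infsum (tm y) (coprime_pairs - {(1, 0), (1, - 1)})"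
    using sub assms by (intro infsum_Un_disjoint summable_tm) auto
  also have "infsum (tm y) {(1, 0), (1, - 1)} = tm y (1, 0) + cnj (tm y (1, 0))"
    using tm_reflect[of 1 0 y] sub assms by simp
  finally show ?thesis by simp
qed

lemma tail_bound:
  assumes y: "y \<ge> 1/2"
  shows "norm (infsum (tm y) (coprime_pairs - {(1, 0), (1, - 1)})) * ((1 + 4 * y\<^sup>2) / 4) powr (real k / 4)
     \<le> (1 + 4 * y\<^sup>2)\<^sup>2 / 4 * \<rho> y powr (real k / 4 - 2) * infsum lattice_majorant UNIV"
proof -
  let ?I = "coprime_pairs - {(1, 0), (1, - 1)}"
  let ?R = "((1 + 4 * y\<^sup>2) / 4) powr (real k / 4)"
  let ?M = "(1 + 4 * y\<^sup>2)\<^sup>2 / 4 * \<rho> y powr (real k / 4 - 2)"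
  have y2: "4 * y\<^sup>2 \<ge> 1" using power_mono[of "1/2" y 2] assms by (simp add: power2_eq_square)
  have bnd: "norm (tm y p) * ?R \<le> ?M * lattice_majorant p" if p: "p \<in> ?I" for p
  proof (rule tm_bound)
    fix d c assume dc: "p = (d, c)"
    let ?D = "(of_int d)\<^sup>2 :: real" and ?E = "(of_int (2 * c + d))\<^sup>2 :: real"
    have I: "(d, c) \<in> coprime_pairs" using p dc by auto
    note ge1 = pair_squares_ge_1[OF I] and odd = coprime_pairs_odd[OF I]
    have nine: "(of_int n)\<^sup>2 \<ge> (9::real)" if "odd n" "\<bar>n\<bar> \<noteq> 1" for n :: int
    proof -
      have "3 \<le> \<bar>n\<bar>" using that by presburger
      then have "3\<^sup>2 \<le> \<bar>n\<bar>\<^sup>2" by (intro power_mono) auto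
      then have "9 \<le> n\<^sup>2" by simp
      then show ?thesis by (metis of_int_le_iff of_int_numeral of_int_power)
    qed
    \<comment> \<open>Only c = 0 and c = -1 give d = 1 and 2 c + d = 1 or -1. Every other pair has
      an odd entry of modulus at least 3; for d \<noteq> 1 the bound also uses 4 y^2 \<ge>
      1.\<close>
    have "9 + 4 * y\<^sup>2 \<le> ?E + ?D * (4 * y\<^sup>2)"
    proof (cases "d = 1")
      case True
      with p dc have "\<bar>2 * c + d\<bar> \<noteq> 1" by auto
      then have "?E \<ge> 9" using odd by (intro nine) auto
      with True show ?thesis by simp
    next
      case False
      then have "?D \<ge> 9" using odd by (intro nine) auto
      then have "9 * (4 * y\<^sup>2) \<le> ?D * (4 * y\<^sup>2)" by (intro mult_right_mono) auto
      then show ?thesis using y2 ge1 by linarith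
    qed
    then show "(1 + 4 * y\<^sup>2) / (?E + ?D * (4 * y\<^sup>2)) \<le> \<rho> y"
      unfolding \<rho>_def by (intro divide_left_mono mult_pos_pos) (use y2 in auto)
  qed (use p y in auto)
  have "norm (infsum (tm y) ?I) * ?R \<le> infsum (\<lambda>p. norm (tm y p)) ?I * ?R"
    using y by (intro mult_right_mono norm_infsum_bound abs_summable_tm) auto
  also have "\<dots> = infsum (\<lambda>p. norm (tm y p) * ?R) ?I"
    by (rule infsum_cmult_left'[symmetric])
  also have "\<dots> \<le> infsum (\<lambda>p. ?M * lattice_majorant p) ?I"
    using y bnd by (intro infsum_mono summable_on_cmult_left abs_summable_tm summable_on_cmult_right
        summable_lattice_majorant) auto
  also have "\<dots> = ?M * infsum lattice_majorant ?I" by (rule infsum_cmult_right')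
  also have "\<dots> \<le> ?M * infsum lattice_majorant UNIV"
    by (intro mult_left_mono infsum_mono2 summable_lattice_majorant)
      (auto simp: lattice_majorant_nonneg)
  finally show ?thesis .
qed

text \<open>For y = tan \<theta> / 2 the main denominator is cis \<theta> / (2 cos \<theta>); the
  normalizing factor cancels its modulus and leaves only the phase.\<close>

lemma main_term:
  assumes \<theta>: "0 \<le> \<theta>" "\<theta> < pi / 2" and y: "y = tan \<theta> / 2"
  shows "Re (tm y (1, 0)) * ((1 + 4 * y\<^sup>2) / 4) powr (real k / 4) = cos (real k * \<theta> / 2 - \<psi>)"
proof -
  have c: "cos \<theta> > 0" using \<theta> by (intro cos_gt_zero_pi) auto
  define r where "r = 1 / (2 * cos \<theta>)"
  have r: "r > 0" using c by (simp add: r_def)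
  have "1 + 4 * y\<^sup>2 = 1 + (tan \<theta>)\<^sup>2" by (simp add: y power_divide)
  also have "\<dots> = 1 / (cos \<theta>)\<^sup>2" using tan_sec[of \<theta>] c by (simp add: inverse_eq_divide power_divide)
  finally have r2: "(1 + 4 * y\<^sup>2) / 4 = r powr 2" using r by (simp add: r_def power_divide power_mult_distrib)
  have w: "w y (1, 0) = of_real r * cis \<theta>"
    using c by (simp add: w_eq complex_eq_iff r_def y tan_def)
  have "Ln (w y (1, 0)) = of_real (ln r) + \<i> * \<theta>"
    using r \<theta> unfolding w by (intro Ln_unique) (auto simp: exp_add cis_conv_exp exp_of_real)
  then have "w y (1, 0) powr (of_nat k / 2) = exp (of_nat k / 2 * (of_real (ln r) + \<i> * \<theta>))"
    using r by (simp add: powr_def w)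
  also have "\<dots> = of_real (r powr (real k / 2)) * cis (real k * \<theta> / 2)"
    using r by (simp add: cis_conv_exp powr_def exp_of_real[symmetric] exp_add[symmetric] algebra_simps)
  finally have "tm y (1, 0) * of_real (r powr (real k / 2)) = cis \<psi> / cis (real k * \<theta> / 2)"
    using r by (simp add: tm_def b_main)
  also have "\<dots> = cis (\<psi> - real k * \<theta> / 2)" by (simp add: cis_divide)
  finally have "Re (tm y (1, 0) * of_real (r powr (real k / 2))) = cos (\<psi> - real k * \<theta> / 2)" by simp
  moreover have "cos (\<psi> - real k * \<theta> / 2) = cos (real k * \<theta> / 2 - \<psi>)"
    by (metis cos_minus minus_diff_eq)
  ultimately show ?thesis unfolding r2 powr_powr by simp
qed

end

section \<open>Counting sign changes\<close>

text \<open>Here T stands for 1 + 4 y^2. Since T + 8 \<le> 5 T and k / 4 - 2 \<ge> k / 8, the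
  logarithm of the power is at most - k / (5 T) \<le> - 3 ln k; the resulting k^(-3) beats T^2 \<le>
  k^2.\<close>

lemma tail_decay:
  fixes T k :: real
  assumes "T \<ge> 2" "k \<ge> 16" "15 * T * ln k \<le> k"
  shows "T\<^sup>2 * (T / (T + 8)) powr (k / 4 - 2) \<le> 1 / k"
proof -
  have "ln (exp 1) \<le> ln k" using assms(2) exp_le by (intro ln_mono) auto
  then have ln1: "ln k \<ge> 1" by simp
  have "T * 1 \<le> 15 * T * ln k" using ln1 assms(1) by (intro mult_mono) auto
  then have Tk: "T \<le> k" using assms(3) by simp
  have "ln (T / (T + 8)) \<le> T / (T + 8) - 1" using assms(1) by (intro ln_le_minus_one) auto
  also have "\<dots> = - (8 / (T + 8))" using assms(1) by (simp add: field_simps)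
  also have "\<dots> \<le> - (8 / (5 * T))" using assms(1) by (simp add: frac_le)
  finally have "(k / 4 - 2) * ln (T / (T + 8)) \<le> (k / 4 - 2) * (- (8 / (5 * T)))"
    using assms(2) by (intro mult_left_mono) auto
  also have "\<dots> \<le> (k / 8) * (- (8 / (5 * T)))"
    using assms(1,2) by (intro mult_right_mono_neg) auto
  also have "\<dots> = - (k / (5 * T))" by simp
  also have "\<dots> \<le> - (3 * ln k)"
    using assms by (simp add: field_simps)
  finally have "exp ((k / 4 - 2) * ln (T / (T + 8))) \<le> exp (- (3 * ln k))" by simp
  also have "exp (- (3 * ln k)) = 1 / k ^ 3"
    using assms(2) by (simp add: exp_minus exp_of_nat_mult[of 3, simplified] inverse_eq_divide)
  finally have p: "(T / (T + 8)) powr (k / 4 - 2) \<le> 1 / k ^ 3"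
    using assms(1) by (simp add: powr_def)
  have "T\<^sup>2 \<le> k\<^sup>2" using Tk assms(1) by (intro power_mono) auto
  then have "T\<^sup>2 * (T / (T + 8)) powr (k / 4 - 2) \<le> k\<^sup>2 * (1 / k ^ 3)"
    using p by (intro mult_mono) auto
  also have "\<dots> = 1 / k" using assms(2) by (simp add: power2_eq_square power3_eq_cube)
  finally show ?thesis .
qed

lemma sin_ge_half:
  fixes x :: real
  assumes "0 \<le> x" "x \<le> 1"
  shows "sin x \<ge> x / 2"
proof -
  have "\<bar>sin x - (\<Sum>m<3. sin_coeff m * x ^ m)\<bar> \<le> inverse (fact 3) * \<bar>x\<bar> ^ 3"
    by (rule Maclaurin_sin_bound)
  moreover have "(\<Sum>m<3. sin_coeff m * x ^ m) = x"
    by (simp add: eval_nat_numeral sin_coeff_def)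
  moreover have "x ^ 3 \<le> x ^ 1" using assms by (intro power_decreasing) auto
  ultimately show ?thesis using assms by (auto simp: fact_numeral abs_if split: if_splits)
qed

lemma zeros_between_sign_changes:
  fixes f :: "real \<Rightarrow> real" and x :: "nat \<Rightarrow> real"
  assumes "\<And>n. x n < x (Suc n)"
    and "continuous_on {x 0..x N} f"
    and "\<And>n. n < N \<Longrightarrow> f (x n) * f (x (Suc n)) < 0"
  shows "\<exists>S. finite S \<and> S \<subseteq> {x 0..x N} \<and> (\<forall>t\<in>S. f t = 0) \<and> card S = N"
  using assms(2,3)
proof (induction N)
  case 0
  show ?case by (intro exI[of _ "{}"]) simp
next
  case (Suc N)
  have less: "x N < x (Suc N)" by (rule assms(1))
  have x0: "x 0 \<le> x N" by (rule lift_Suc_mono_le[of x]) (simp_all add: assms(1) less_imp_le)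
  have "continuous_on {x 0..x N} f"
    using Suc.prems(1) by (rule continuous_on_subset) (use less in auto)
  with Suc obtain S where S: "finite S" "S \<subseteq> {x 0..x N}" "\<forall>t\<in>S. f t = 0" "card S = N"
    by auto
  have c: "continuous_on {x N..x (Suc N)} f"
    using Suc.prems(1) by (rule continuous_on_subset) (use x0 in auto)
  have neg: "f (x N) * f (x (Suc N)) < 0" using Suc.prems(2) by simp
  have "\<exists>t. x N \<le> t \<and> t \<le> x (Suc N) \<and> f t = 0"
  proof (cases "f (x N) < 0")
    case True
    then show ?thesis using neg c less by (intro IVT') (auto simp: mult_less_0_iff)
  next
    case False
    then show ?thesis using neg c less by (intro IVT2') (auto simp: mult_less_0_iff)
  qed
  then obtain t where t: "x N \<le> t" "t \<le> x (Suc N)" "f t = 0" by blast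
  \<comment> \<open>The function is nonzero at the nodes, so no zero is counted twice at a shared
    endpoint.\<close>
  have "t \<noteq> x N" using neg t by auto
  then have "t \<notin> S" using S(2) t(1) by auto
  with S have "card (insert t S) = Suc N" by simp
  moreover have "insert t S \<subseteq> {x 0..x (Suc N)}" using S(2) t x0 less by auto
  ultimately show ?case using S t by (intro exI[of _ "insert t S"]) auto
qed

definition majorant_sum :: real where
  "majorant_sum = infsum lattice_majorant UNIV"

lemma majorant_sum_nonneg: "majorant_sum \<ge> 0"
  unfolding majorant_sum_def by (intro infsum_nonneg lattice_majorant_nonneg)

context symmetric_series
begin

lemma k_pos [simp]: "real k > 0" "k > 0"
  using k_ge by auto

text \<open>The normalized tail stays below 2, the amplitude of the main term, so the sign of F at
  an extremum is that of the cosine.\<close>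

lemma F_near_cos:
  assumes large: "majorant_sum < k"
    and \<theta>: "pi / 4 \<le> \<theta>" "\<theta> < pi / 2" and T: "15 * (1 / (cos \<theta>)\<^sup>2) * ln k \<le> k"
  obtains R where "R > 0" "\<bar>Re (F (tan \<theta> / 2)) * R - 2 * cos (real k * \<theta> / 2 - \<psi>)\<bar> < 2"
proof -
  define y where "y = tan \<theta> / 2"
  define R where "R = ((1 + 4 * y\<^sup>2) / 4) powr (real k / 4)"
  let ?s = "infsum (tm y) (coprime_pairs - {(1, 0), (1, - 1)})"
  have "cos \<theta> > 0" using \<theta> by (intro cos_gt_zero_pi) auto
  then have Tc: "1 + 4 * y\<^sup>2 = 1 / (cos \<theta>)\<^sup>2"
    using tan_sec[of \<theta>] by (simp add: y_def inverse_eq_divide power_divide)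
  have "tan (pi / 4) \<le> tan \<theta>" using \<theta> by (intro tan_mono_le) auto
  then have y: "y \<ge> 1/2" by (simp add: y_def tan_45)
  then have T2: "1 + 4 * y\<^sup>2 \<ge> 2" using power_mono[of "1/2" y 2] by (simp add: power2_eq_square)
  have R: "R > 0" using T2 by (simp add: R_def)
  have main: "Re (tm y (1, 0)) * R = cos (real k * \<theta> / 2 - \<psi>)"
    unfolding R_def using \<theta> by (intro main_term) (auto simp: y_def)
  have \<rho>: "\<rho> y = (1 + 4 * y\<^sup>2) / ((1 + 4 * y\<^sup>2) + 8)" by (simp add: \<rho>_def)
  have "(1 + 4 * y\<^sup>2)\<^sup>2 * \<rho> y powr (real k / 4 - 2) \<le> 1 / k"
    unfolding \<rho> using T2 k_ge T unfolding Tc by (intro tail_decay) auto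
  then have "(1 + 4 * y\<^sup>2)\<^sup>2 * \<rho> y powr (real k / 4 - 2) * (majorant_sum / 4) \<le> 1 / k * (majorant_sum / 4)"
    using majorant_sum_nonneg by (intro mult_right_mono) auto
  also have "\<dots> < 2" using large by (simp add: field_simps)
  finally have "norm ?s * R < 2"
    using tail_bound[OF y] by (simp add: R_def majorant_sum_def)
  moreover have "\<bar>Re ?s * R\<bar> \<le> norm ?s * R"
    using R by (simp add: abs_mult abs_Re_le_cmod)
  ultimately have "\<bar>Re ?s * R\<bar> < 2" by linarith
  moreover have "Re (F y) * R - 2 * cos (real k * \<theta> / 2 - \<psi>) = Re ?s * R"
    unfolding F_split[OF y] main[symmetric] by (simp add: algebra_simps)
  ultimately show ?thesis using that[of R] R by (simp add: y_def)
qed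

lemma many_zeros:
  assumes large: "majorant_sum < k"
  shows "\<exists>S. finite S \<and> S \<subseteq> {y. y \<ge> 1/2 \<and> F y = 0} \<and>
    real (card S) \<ge> real k / 8 - 4 * sqrt (real k * ln (real k))"
proof -
  define q where "q = sqrt (real k * ln (real k))"
  \<comment> \<open>A distance \<phi> from pi / 2 forces cos \<theta> \<ge> \<phi> / 2, and 60 = 4 *
    15 turns this into the hypothesis of \<open>F_near_cos\<close>.\<close>
  define \<phi> where "\<phi> = sqrt (60 * ln k / k)"
  define U where "U = pi / 2 - \<phi>"
  \<comment> \<open>The length of the interval from pi / 4 to \<open>U\<close>, in units of the
    spacing 2 pi / k of the extrema.\<close>
  define L where "L = k / 8 - k * \<phi> / (2 * pi)"
  have "ln (exp 1) \<le> ln (real k)" using k_ge exp_le by (intro ln_mono) auto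
  then have ln1: "ln (real k) \<ge> 1" by simp
  then have pos: "60 * ln (real k) / real k > 0" using k_ge by (intro divide_pos_pos mult_pos_pos) auto
  then have \<phi>_sq: "\<phi>\<^sup>2 = 60 * ln k / k" by (simp only: \<phi>_def real_sqrt_pow2 less_imp_le)
  from pos have \<phi>: "\<phi> > 0" by (simp only: \<phi>_def real_sqrt_gt_0_iff)
  have "real k * ln (real k) \<ge> 16 * 1" using k_ge ln1 by (intro mult_mono) auto
  then have q4: "q \<ge> 4" unfolding q_def by (intro real_le_rsqrt) simp
  \<comment> \<open>Rounding 60 up to 64 gives k \<phi> \<le> 8 q. The loss is then at most 4 q / 3,
    and since q \<ge> 4 the constant 4 also absorbs the 2 lost by rounding.\<close>
  have "(real k * \<phi>)\<^sup>2 = 60 * (real k * ln (real k))"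
    unfolding power_mult_distrib \<phi>_sq by (simp add: power2_eq_square)
  also have "\<dots> \<le> 64 * (real k * ln (real k))" using ln1 k_ge by simp
  also have "\<dots> = (8 * q)\<^sup>2" using ln1 k_ge by (simp add: q_def power_mult_distrib)
  finally have "real k * \<phi> \<le> 8 * q" by (rule power2_le_imp_le) (use q4 in auto)
  then have "real k * \<phi> / (2 * pi) \<le> 8 * q / (2 * 3)"
    using pi_gt3 q4 \<phi> by (intro frac_le) auto
  then have L: "real k / 8 - 4 * q \<le> L - 2" using q4 by (simp add: L_def)
  show ?thesis
  proof (cases "L < 2")
    case True
    \<comment> \<open>The claimed lower bound is negative here, so the empty set suffices.\<close>
    then show ?thesis using L by (intro exI[of _ "{}"]) (simp add: q_def)
  next
    case False
    \<comment> \<open>The nodes \<open>x n\<close> solve k \<theta> / 2 - \<psi> = (j0 + n) pi, and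
      \<open>j0\<close> is the least index with x 0 \<ge> pi / 4. Rounding it up costs at most one
      spacing, hence L - 1, which keeps x N \<le> U.\<close>
    define N where "N = nat \<lfloor>L - 1\<rfloor>"
    define j0 where "j0 = \<lceil>k / 8 - \<psi> / pi\<rceil>"
    define x where "x n = 2 * (of_int (j0 + int n) * pi + \<psi>) / k" for n
    define f where "f t = Re (F (tan t / 2))" for t
    have N: "L - 2 \<le> real N" "real N \<le> L - 1" using False unfolding N_def by linarith+
    have x_less: "x n < x (Suc n)" for n
      unfolding x_def by (intro divide_strict_right_mono) (auto simp: algebra_simps)
    have x_mono: "x m \<le> x n" if "m \<le> n" for m n
      by (rule lift_Suc_mono_le[of x]) (simp_all add: x_less less_imp_le that)
    have "k / 8 - \<psi> / pi \<le> j0" unfolding j0_def by linarith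
    then have x0: "pi / 4 \<le> x 0" by (simp add: x_def field_simps)
    have "j0 + real N \<le> k / 8 - \<psi> / pi + 1 + (L - 1)" using N(2) unfolding j0_def by linarith
    then have "(j0 + real N) * pi \<le> (k / 8 - \<psi> / pi + 1 + (L - 1)) * pi"
      by (intro mult_right_mono) auto
    also have "\<dots> = k * U / 2 - \<psi>" by (simp add: L_def U_def field_simps)
    finally have xN: "x N \<le> U" by (simp add: x_def field_simps)
    have U2: "U < pi / 2" using \<phi> by (simp add: U_def)
    have rng: "pi / 4 \<le> x n" "x n \<le> U" if "n \<le> N" for n
      using x_mono[of 0 n] x_mono[of n N] x0 xN that by auto
    define sg :: "nat \<Rightarrow> real" where "sg n = (if even (j0 + int n) then 1 else - 1)" for n
    have sgn: "sg n * f (x n) > 0" if "n \<le> N" for n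
    proof -
      define \<theta> where "\<theta> = x n"
      have \<theta>: "pi / 4 \<le> \<theta>" "\<theta> \<le> U" using rng[OF that] by (auto simp: \<theta>_def)
      have "\<phi> / 2 \<le> (pi / 2 - \<theta>) / 2" using \<theta> by (simp add: U_def)
      \<comment> \<open>The argument is at most pi / 4 < 1, as \<open>sin_ge_half\<close>
        requires.\<close>
      also have "\<dots> \<le> sin (pi / 2 - \<theta>)"
        using \<theta> U2 pi_less_4 by (intro sin_ge_half) auto
      also have "\<dots> = cos \<theta>" by (simp add: sin_diff)
      finally have "\<phi> / 2 \<le> cos \<theta>" .
      then have "(\<phi> / 2)\<^sup>2 \<le> (cos \<theta>)\<^sup>2" using \<phi> by (intro power_mono) auto
      moreover have "(\<phi> / 2)\<^sup>2 = 15 * ln k / k" unfolding power_divide \<phi>_sq by simp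
      ultimately have "15 * ln k / k \<le> (cos \<theta>)\<^sup>2" by simp
      moreover have "cos \<theta> > 0" using \<theta> U2 by (intro cos_gt_zero_pi) auto
      ultimately have T: "15 * (1 / (cos \<theta>)\<^sup>2) * ln k \<le> k"
        by (simp add: field_simps)
      obtain R where R: "R > 0" "\<bar>f \<theta> * R - 2 * cos (real k * \<theta> / 2 - \<psi>)\<bar> < 2"
        unfolding f_def by (rule F_near_cos[OF large \<theta>(1) le_less_trans[OF \<theta>(2) U2] T])
      define A where "A = pi * of_int (j0 + int n)"
      have "real k * \<theta> = 2 * (A + \<psi>)" by (simp add: \<theta>_def x_def A_def mult.commute)
      then have "real k * \<theta> / 2 - \<psi> = A" by (simp add: field_simps)
      then have "cos (real k * \<theta> / 2 - \<psi>) = sg n"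
        by (simp only: A_def cos_npi_int sg_def)
      then have "sg n * (f \<theta> * R) > 0"
        using R(2) by (auto simp: sg_def abs_less_iff split: if_splits)
      then show ?thesis using R(1) by (simp add: \<theta>_def zero_less_mult_iff mult_less_0_iff)
    qed
    have cont: "continuous_on {x 0..x N} f"
      unfolding f_def
    proof (intro continuous_on_Re continuous_on_compose2[OF continuous_F[of "tan U / 2"]])
      show "continuous_on {x 0..x N} (\<lambda>t. tan t / 2)"
        using x0 xN U2 by (intro continuous_intros) (auto intro!: less_imp_neq[THEN not_sym] cos_gt_zero_pi)
      have "1 \<le> tan t \<and> tan t \<le> tan U" if "t \<in> {x 0..x N}" for t
        using tan_mono_le[of "pi / 4" t] tan_mono_le[of t U] that x0 xN U2 by (auto simp: tan_45)
      then show "(\<lambda>t. tan t / 2) ` {x 0..x N} \<subseteq> {1 / 2..tan U / 2}" by auto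
    qed
    have alt: "f (x n) * f (x (Suc n)) < 0" if "n < N" for n
      using sgn[of n] sgn[of "Suc n"] that by (auto simp: sg_def mult_less_0_iff split: if_splits)
    obtain S where S: "finite S" "S \<subseteq> {x 0..x N}" "\<forall>t\<in>S. f t = 0" "card S = N"
      using zeros_between_sign_changes[of x N f] x_less cont alt by auto
    have inS: "pi / 4 \<le> t \<and> t < pi / 2" if "t \<in> S" for t
      using that S(2) x0 xN U2 by fastforce
    let ?g = "\<lambda>t::real. tan t / 2"
    have "inj_on ?g S"
    proof (rule inj_onI)
      fix s t assume "s \<in> S" "t \<in> S" "?g s = ?g t"
      then show "s = t"
        using tan_monotone[of s t] tan_monotone[of t s] inS[of s] inS[of t] by fastforce
    qed
    then have "card (?g ` S) = N" using S(4) by (simp add: card_image)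
    moreover have "?g ` S \<subseteq> {y. y \<ge> 1/2 \<and> F y = 0}"
    proof safe
      fix t assume t: "t \<in> S"
      show y: "1 / 2 \<le> tan t / 2"
        using tan_mono_le[of "pi / 4" t] inS[OF t] by (simp add: tan_45)
      show "F (tan t / 2) = 0"
        using Im_F[of "tan t / 2"] S(3) t y by (auto simp: f_def complex_eq_iff)
    qed
    ultimately show ?thesis
      using S(1) N(1) L by (intro exI[of _ "?g ` S"]) (simp add: q_def)
  qed
qed

end

section \<open>The two Eisenstein series\<close>

lemma cis_half_turns: "(- 1) ^ k = cis (pi * real k)"
  by (metis Complex.DeMoivre cis_pi mult.commute)

text \<open>The prefactor cancels the k-th power of \<open>gauss_sign 1 8\<close>, so \<psi> = 0.
  The sign (-1)^k from \<open>gauss_sign_add_half\<close> is the phase pi k, which splits with the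
  prefactor as - pi k / 4 + pi k = pi k / 2 + pi k / 4.\<close>

lemma E_half_series:
  assumes "k \<ge> 16"
  defines "b \<equiv> \<lambda>(d, c). exp (- (of_real pi * \<i> * of_nat k / 4)) * gauss_sign (d - 2 * c) (8 * d) ^ k"
  shows "symmetric_series k b 0" "E_half k (Complex (1/2) y) = symmetric_series.F k b y"
proof -
  have e: "exp (- (of_real pi * \<i> * of_nat k / 4)) = cis (- (pi * k / 4))"
    by (simp add: cis_conv_exp mult_ac)
  show *: "symmetric_series k b 0"
  proof
    fix p assume "p \<in> coprime_pairs"
    show "norm (b p) \<le> 1"
      unfolding b_def e
      by (auto simp: norm_mult norm_power power_le_one norm_gauss_sign_le split: prod.split)
  next
    fix d c assume dc: "(d, c) \<in> coprime_pairs"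
    have "gauss_sign (d - 2 * (- d - c)) (8 * d) = gauss_sign (- (d - 2 * c) + 4 * d) (8 * d)"
      by (simp add: algebra_simps)
    also have "\<dots> = - cnj (gauss_sign (d - 2 * c) (8 * d))"
      using coprime_pairs_odd[OF dc] by (subst gauss_sign_add_half) (auto simp: gauss_sign_minus[symmetric])
    finally have "b (d, - d - c) = cis (- (pi * k / 4)) * ((- 1) ^ k * cnj (gauss_sign (d - 2 * c) (8 * d)) ^ k)"
      unfolding b_def e by (simp only: prod.case power_minus[of "cnj _"])
    also have "\<dots> = cis (- (pi * k / 4) + pi * k) * cnj (gauss_sign (d - 2 * c) (8 * d)) ^ k"
      by (simp only: cis_half_turns mult.assoc flip: cis_mult)
    also have "- (pi * k / 4) + pi * k = pi * k / 2 + pi * k / 4" by simp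
    finally show "b (d, - d - c) = cis (pi * k / 2) * cnj (b (d, c))"
      unfolding b_def e
      by (simp only: prod.case cis_cnj complex_cnj_mult complex_cnj_power minus_minus mult.assoc
          flip: cis_mult)
  next
    show "b (1, 0) = cis 0"
      unfolding b_def e by (simp add: gauss_sign_1_8 Complex.DeMoivre cis_mult mult.commute)
  qed (use assms in simp)
  have "exp (- (of_real pi * \<i> * of_nat k / 4)) * (gauss_sign (d - 2 * c) (8 * d) ^ k /
      (of_int d * Complex (1/2) y + of_int c) powr (of_nat k / 2)) = symmetric_series.tm k b y (d, c)" for d c
    unfolding symmetric_series.tm_def[OF *] symmetric_series.w_def[OF *] prod.case
    by (simp add: b_def)
  then have "E_half k (Complex (1/2) y) =
      infsum (symmetric_series.tm k b y) {(d, c). d > 0 \<and> gcd (2 * c) d = 1}"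
    unfolding E_half_def infsum_cmult_right'[symmetric] by (intro infsum_cong) auto
  also have "{(d, c). d > 0 \<and> gcd (2 * c) d = 1} = coprime_pairs"
    unfolding coprime_pairs_def by (simp only: gcd.commute)
  finally show "E_half k (Complex (1/2) y) = symmetric_series.F k b y"
    by (simp only: symmetric_series.F_def[OF *])
qed

text \<open>Replacing c by c + d moves the line from -1/2 to 1/2, and the symbol is periodic modulo
  d. The factor \<open>cis (pi * k / 4)\<close> is half of the reflection phase, which makes the
  series real.\<close>

lemma E_zero_series:
  assumes "k \<ge> 16" "odd k"
  defines "b \<equiv> \<lambda>(d, c). cis (pi * k / 4) * (of_int (jacobi (- c) d) * eps d ^ k)"
  shows "symmetric_series k b (pi * k / 4)"
    "cis (pi * k / 4) * E_zero k (Complex (- 1/2) y) = symmetric_series.F k b y"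
proof -
  show *: "symmetric_series k b (pi * k / 4)"
  proof
    fix p assume "p \<in> coprime_pairs"
    have "norm (of_int (jacobi a u) :: complex) \<le> 1" for a u
      using abs_jacobi_le[of a u] by (metis norm_of_int of_int_abs of_int_le_1_iff)
    then show "norm (b p) \<le> 1"
      by (auto simp: b_def norm_mult norm_power split: prod.split)
  next
    fix d c assume dc: "(d, c) \<in> coprime_pairs"
    have "jacobi (- (- d - c)) d = jacobi (- (- c)) d"
      by (intro jacobi_cong) (simp add: cong_def)
    also have "\<dots> = chi4 d * jacobi (- c) d"
      using coprime_pairs_odd[OF dc] by (intro jacobi_minus)
    finally have 1: "jacobi (- (- d - c)) d = chi4 d * jacobi (- c) d" .
    \<comment> \<open>Odd k is essential: conjugating \<open>eps d ^ k\<close> yields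
      \<open>chi4 d ^ k\<close>, which has to match the single sign from the Jacobi symbol.\<close>
    have "chi4 d ^ k = chi4 d" using \<open>odd k\<close> by (simp add: chi4_def)
    then have "cnj (eps d ^ k) = of_int (chi4 d) * eps d ^ k"
      by (simp add: cnj_eps power_mult_distrib flip: of_int_power)
    then have "cnj (b (d, c)) = cis (- (pi * k / 4)) * of_int (jacobi (- (- d - c)) d) * eps d ^ k"
      unfolding b_def 1 by (simp add: cis_cnj)
    moreover have "cis (pi * k / 2) * cis (- (pi * k / 4)) = cis (pi * k / 4)"
      by (simp add: cis_mult)
    ultimately show "b (d, - d - c) = cis (pi * k / 2) * cnj (b (d, c))"
      unfolding b_def by (simp add: mult.assoc[symmetric])
  next
    show "b (1, 0) = cis (pi * k / 4)"
      by (simp add: b_def jacobi_def eps_def)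
  qed (use assms in simp)
  let ?T = "\<lambda>(u, v). of_int (jacobi (- v) u) * eps u ^ k /
    (of_int u * Complex (- 1/2) y + of_int v) powr (of_nat k / 2)"
  have bij: "bij_betw (\<lambda>(d, c). (d, c + d)) coprime_pairs coprime_pairs"
    by (rule bij_betwI[of _ _ _ "\<lambda>(d, c). (d, c - d)"]) (auto simp: coprime_pairs_shift)
  have "E_zero k (Complex (- 1/2) y) = infsum ?T coprime_pairs"
    by (simp add: E_zero_def coprime_pairs_def)
  also have "\<dots> = infsum (\<lambda>p. ?T ((\<lambda>(d, c). (d, c + d)) p)) coprime_pairs"
    by (rule infsum_reindex_bij_betw[OF bij, symmetric])
  finally have "cis (pi * k / 4) * E_zero k (Complex (- 1/2) y) =
      infsum (\<lambda>p. cis (pi * k / 4) * ?T ((\<lambda>(d, c). (d, c + d)) p)) coprime_pairs"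
    by (simp only: infsum_cmult_right')
  also have "\<dots> = infsum (symmetric_series.tm k b y) coprime_pairs"
  proof (rule infsum_cong)
    fix p :: "int \<times> int"
    obtain d c where p: "p = (d, c)" by fastforce
    have "jacobi (- (c + d)) d = jacobi (- c) d"
      by (intro jacobi_cong) (simp add: cong_def mod_simps)
    moreover have "of_int d * Complex (- 1/2) y + of_int (c + d) = of_int d * Complex (1/2) y + of_int c"
      by (simp add: complex_eq_iff)
    ultimately show "cis (pi * k / 4) * ?T ((\<lambda>(d, c). (d, c + d)) p) = symmetric_series.tm k b y p"
      unfolding symmetric_series.tm_def[OF *] symmetric_series.w_def[OF *] p prod.case
      by (simp only: b_def prod.case times_divide_eq_right)
  qed
  finally show "cis (pi * k / 4) * E_zero k (Complex (- 1/2) y) = symmetric_series.F k b y"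
    by (simp add: symmetric_series.F_def[OF *])
qed

theorem theorem1:
  "\<exists>C::real. C > 0 \<and> (\<exists>K::nat. \<forall>k::nat. k \<ge> K \<longrightarrow> k \<ge> 5 \<longrightarrow> odd k \<longrightarrow>
     (\<exists>S::real set. finite S \<and> S \<subseteq> {y. y \<ge> 1/2 \<and> E_zero k (Complex (-1/2) y) = 0} \<and>
        real (card S) \<ge> real k / 8 - C * sqrt (real k * ln (real k))) \<and>
     (\<exists>S::real set. finite S \<and> S \<subseteq> {y. y \<ge> 1/2 \<and> E_half k (Complex (1/2) y) = 0} \<and>
        real (card S) \<ge> real k / 8 - C * sqrt (real k * ln (real k))))"
proof -
  \<comment> \<open>The majorant does not involve k, so one threshold serves both series.\<close>
  obtain K0 :: nat where K0: "majorant_sum < real K0" using reals_Archimedean2 by blast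
  have "(\<exists>S. finite S \<and> S \<subseteq> {y. y \<ge> 1/2 \<and> E_zero k (Complex (-1/2) y) = 0} \<and>
        real (card S) \<ge> real k / 8 - 4 * sqrt (real k * ln (real k))) \<and>
     (\<exists>S. finite S \<and> S \<subseteq> {y. y \<ge> 1/2 \<and> E_half k (Complex (1/2) y) = 0} \<and>
        real (card S) \<ge> real k / 8 - 4 * sqrt (real k * ln (real k)))"
    if k: "k \<ge> max 16 K0" "odd k" for k
  proof
    have large: "majorant_sum < real k" using K0 k by simp
    have k16: "k \<ge> 16" using k by simp
    \<comment> \<open>The constant has modulus 1, so multiplying by it keeps the zeros.\<close>
    have "E_zero k (Complex (-1/2) y) = 0 \<longleftrightarrow> cis (pi * k / 4) * E_zero k (Complex (-1/2) y) = 0" for y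
      by simp
    then show "\<exists>S. finite S \<and> S \<subseteq> {y. y \<ge> 1/2 \<and> E_zero k (Complex (-1/2) y) = 0} \<and>
        real (card S) \<ge> real k / 8 - 4 * sqrt (real k * ln (real k))"
      using symmetric_series.many_zeros[OF E_zero_series(1)[OF k16 k(2)] large]
      unfolding E_zero_series(2)[OF k16 k(2)] by simp
    show "\<exists>S. finite S \<and> S \<subseteq> {y. y \<ge> 1/2 \<and> E_half k (Complex (1/2) y) = 0} \<and>
        real (card S) \<ge> real k / 8 - 4 * sqrt (real k * ln (real k))"
      using symmetric_series.many_zeros[OF E_half_series(1)[OF k16] large]
      unfolding E_half_series(2)[OF k16] .
  qed
  then show ?thesis
    by (intro exI[of _ "4::real"] conjI exI[of _ "max 16 K0"]) auto
qed

end
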